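(* Consider the power network with first-order turbine dynamics described in the context, with parameters proportional to rating: $m_i=f_im$, $d_i=f_id$, $r_i^{-1}=f_ir^{-1}$, $\tau_i=\tau$, where $f_i>0$ and $m,d,r,\tau>0$, subject to the step disturbance $u(t)=u_0\mathbf{1}_{t\ge0}$. Then, under the under-damped condition $$\frac{d+r^{-1}}{m\tau}-\frac14\left(\frac1\tau+\frac dm\right)^2>0,$$ the maximum deviation $\|\bar w\|_\infty$ of the system frequency is a decreasing function of $m$ (with $d,r,\tau,f_i,u_0$ held fixed), i.e. $$\frac{\partial}{\partial m}\|\bar w\|_\infty<0.$$
   Context: There are $n$ generator buses with phase angles $\theta_i$, frequencies $w_i$ and turbine powers $q_i$ (deviations from equilibrium) satisfying $$\dot\theta_i=w_i,\qquad m_i\dot w_i=-d_iw_i+q_i+u_i-p^e_i,\qquad \tau_i\dot q_i=-r_i^{-1}w_i-q_i,$$ with zero initial conditions, where $p^e=L\theta$ and $L\in\mathbb{R}^{n\times n}$ is a symmetric positive semidefinite weighted graph Laplacian of rank $n-1$ with kernel spanned by the all-ones vector. Equivalently, bus $i$ has transfer function from net power $u_i-p_i^e$ to $\theta_i$ given by $g_i(s)=\frac{\tau_is+1}{s(m_i\tau_is^2+(m_i+d_i\tau_i)s+d_i+r_i^{-1})}$, and the proportionality of parameters means $g_i(s)=\frac1{f_i}g_0(s)$ with the representative machine $g_0(s)=\frac{\tau s+1}{s(m\tau s^2+(m+d\tau)s+d+r^{-1})}$. The disturbance is a step in a given vector direction $u_0=(u_{01},\dots,u_{0n})\in\mathbb{R}^n$.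 The system frequency is $\bar w(t):=\frac{\sum_if_iw_i(t)}{\sum_if_i}$, and $\|\bar w\|_\infty:=\sup_{t\ge0}|\bar w(t)|$.
   Formalization: The formal theorem additionally assumes that the entries of u_0 sum to a nonzero number; if they sum to zero, the system frequency is identically zero for every m, so the derivative is 0 and the strict inequality fails. *)

theory Defs
  imports "HOL-Analysis.Analysis"
begin

definition weighted_laplacian :: "('n::finite \<Rightarrow> 'n \<Rightarrow> real) \<Rightarrow> real^'n^'n" where
  "weighted_laplacian a = (\<chi> i j. if i = j then (\<Sum>k\<in>UNIV - {i}. a i k) else - a i j)"

text \<open>The weights come from linearized power flow and are not required to be nonnegative;
  positive semidefiniteness is therefore a separate condition. For nonnegative weights it
  holds automatically.\<close>

definition network_laplacian :: "real^'n::finite^'n \<Rightarrow> bool" where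
  "network_laplacian L \<longleftrightarrow>
     (\<exists>a. (\<forall>i j. a i j = a j i) \<and> L = weighted_laplacian a) \<and>
     transpose L = L \<and>
     (\<forall>x. 0 \<le> x \<bullet> (L *v x)) \<and>
     rank L = CARD('n) - 1 \<and>
     {x. L *v x = 0} = span {\<chi> i. 1}"

definition step_input :: "real^'n::finite \<Rightarrow> real \<Rightarrow> real^'n" where
  "step_input u0 t = indicator {0..} t *\<^sub>R u0"

text \<open>The swing and turbine equations on \<open>t \<ge> 0\<close> with zero initial conditions; derivatives at
  \<open>t = 0\<close> are one-sided, because the input jumps there. The constant factors \<open>mi $ i\<close> and
  \<open>\<tau>i $ i\<close> are kept under the derivative so that no division is needed.\<close>

definition network_trajectory ::
  "real^'n::finite^'n \<Rightarrow> real^'n \<Rightarrow> real^'n \<Rightarrow> real^'n \<Rightarrow> real^'n \<Rightarrow> (real \<Rightarrow> real^'n) \<Rightarrow>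
   (real \<Rightarrow> real^'n) \<Rightarrow> (real \<Rightarrow> real^'n) \<Rightarrow> (real \<Rightarrow> real^'n) \<Rightarrow> bool" where
  "network_trajectory L mi di ri \<tau>i u \<theta> w q \<longleftrightarrow>
     \<theta> 0 = 0 \<and> w 0 = 0 \<and> q 0 = 0 \<and>
     (\<forall>t\<ge>0. \<forall>i.
        ((\<lambda>t. \<theta> t $ i) has_real_derivative w t $ i) (at t within {0..}) \<and>
        ((\<lambda>t. mi $ i * w t $ i) has_real_derivative
           - di $ i * w t $ i + q t $ i + u t $ i - (L *v \<theta> t) $ i) (at t within {0..}) \<and>
        ((\<lambda>t. \<tau>i $ i * q t $ i) has_real_derivative
           - inverse (ri $ i) * w t $ i - q t $ i) (at t within {0..}))"

definition system_frequency :: "real^'n::finite \<Rightarrow> (real \<Rightarrow> real^'n) \<Rightarrow> real \<Rightarrow> real" where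
  "system_frequency f w t = (\<Sum>i\<in>UNIV. f $ i * w t $ i) / (\<Sum>i\<in>UNIV. f $ i)"

text \<open>This is the usual sup-norm when the signal is bounded on \<open>t \<ge> 0\<close>. The supremum of an
  unbounded set of reals is unspecified.\<close>

definition sup_norm :: "(real \<Rightarrow> real) \<Rightarrow> real" where
  "sup_norm x = (SUP t\<in>{0..}. \<bar>x t\<bar>)"

definition underdamped :: "real \<Rightarrow> real \<Rightarrow> real \<Rightarrow> real \<Rightarrow> bool" where
  "underdamped m d r \<tau> \<longleftrightarrow>
     (d + inverse r) / (m * \<tau>) - 1/4 * (1 / \<tau> + d / m)\<^sup>2 > 0"

end

theory Submission imports Defs
begin

text \<open>Averaging the swing equations cancels the network term, so the system frequency is
  \<open>U = (\<Sum> u0) / (\<Sum> f)\<close> times the unit step response of a single second-order machine.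
  After its first peak the response stays within the peak deviation from its limit, because
  \<open>\<bar>cos x + \<delta> sin x\<bar> \<le> 1 + \<delta> x \<le> exp (\<delta> x)\<close>; hence the norm is \<open>\<bar>U\<bar>\<close> times the peak value, which has
  a closed form. The sign of its derivative in \<open>m\<close> reduces to \<open>\<phi> cos \<phi> < sin \<phi>\<close> on \<open>(0, \<pi>)\<close>.
  Finally the discriminant is concave in \<open>m\<close>, so the under-damped masses form an interval and
  the pointwise sign gives strict monotonicity.\<close>

section \<open>Averaging the network into one machine\<close>

text \<open>The all-ones vector spans the kernel, and symmetry lets \<open>L\<close> act on it
  instead of on \<open>x\<close>.\<close>

lemma network_laplacian_sum_zero:
  fixes L :: "real^'n::finite^'n"
  assumes "network_laplacian L"
  shows "(\<Sum>i\<in>UNIV. (L *v x) $ i) = 0"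
proof -
  let ?e = "(\<chi> i. 1) :: real^'n"
  have e: "L *v ?e = 0" and sym: "transpose L = L"
    using assms span_base[of ?e "{?e}"] by (auto simp: network_laplacian_def)
  have "(\<Sum>i\<in>UNIV. (L *v x) $ i) = ?e \<bullet> (L *v x)"
    by (simp add: inner_vec_def)
  also have "\<dots> = (transpose L *v ?e) \<bullet> x"
    by (simp add: dot_lmul_matrix)
  finally show ?thesis by (simp add: sym e)
qed

text \<open>Here \<open>x\<close> is the rating-weighted mean frequency, \<open>y\<close> the total
  turbine power per unit of rating, \<open>k\<close> the inverse droop and \<open>U\<close> the
  disturbance per unit of rating. Derivatives are taken within \<open>{0..}\<close> to match
  \<open>network_trajectory\<close>.\<close>

definition mean_machine ::
  "real \<Rightarrow> real \<Rightarrow> real \<Rightarrow> real \<Rightarrow> real \<Rightarrow> (real \<Rightarrow> real) \<Rightarrow> (real \<Rightarrow> real) \<Rightarrow> bool" where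
  "mean_machine d k \<tau> m U x y \<longleftrightarrow> x 0 = 0 \<and> y 0 = 0 \<and>
     (\<forall>t\<ge>0. (x has_real_derivative (U - d * x t + y t) / m) (at t within {0..}) \<and>
             (y has_real_derivative (- k * x t - y t) / \<tau>) (at t within {0..}))"

text \<open>Under proportional parameters every inertia, damping and droop term sums to a multiple
  of the same quantity \<open>X\<close>. Turbine powers are summed without weights because they
  already scale with the rating.\<close>

lemma network_trajectory_mean_machine:
  fixes f u0 :: "real^'n::finite"
  assumes L: "network_laplacian L"
    and traj: "network_trajectory L mi di ri \<tau>i (step_input u0) \<theta> w q"
    and pos: "\<And>i. f $ i > 0" "m > 0" "\<tau> > 0"
    and par: "\<And>i. mi $ i = f $ i * m" "\<And>i. di $ i = f $ i * d"
      "\<And>i. inverse (ri $ i) = f $ i * k" "\<And>i. \<tau>i $ i = \<tau>"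
  shows "mean_machine d k \<tau> m ((\<Sum>i\<in>UNIV. u0 $ i) / (\<Sum>i\<in>UNIV. f $ i))
           (system_frequency f w) (\<lambda>t. (\<Sum>i\<in>UNIV. q t $ i) / (\<Sum>i\<in>UNIV. f $ i))"
proof -
  define F where "F = (\<Sum>i\<in>UNIV. f $ i)"
  define X where "X t = (\<Sum>i\<in>UNIV. f $ i * w t $ i)" for t
  define Y where "Y t = (\<Sum>i\<in>UNIV. q t $ i)" for t
  define V where "V = (\<Sum>i\<in>UNIV. u0 $ i)"
  have F: "F > 0" unfolding F_def by (rule sum_pos) (auto simp: pos)
  have X': "(X has_real_derivative (V - d * X t + Y t) / m) (at t within {0..})"
    if t: "t \<ge> 0" for t
  proof -
    have "((\<lambda>t. \<Sum>i\<in>UNIV. mi $ i * w t $ i) has_real_derivative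
        (\<Sum>i\<in>UNIV. - di $ i * w t $ i + q t $ i + step_input u0 t $ i - (L *v \<theta> t) $ i))
        (at t within {0..})"
      using traj t by (intro DERIV_sum) (auto simp: network_trajectory_def)
    moreover have "(\<Sum>i\<in>UNIV. - di $ i * w t $ i + q t $ i + step_input u0 t $ i - (L *v \<theta> t) $ i)
        = V - d * X t + Y t"
      using t by (simp add: sum.distrib sum_subtractf network_laplacian_sum_zero[OF L] par
          step_input_def V_def X_def Y_def sum_distrib_left sum_negf mult_ac)
    moreover have "(\<lambda>t. \<Sum>i\<in>UNIV. mi $ i * w t $ i) = (\<lambda>t. m * X t)"
      by (simp add: par X_def sum_distrib_left mult_ac)
    ultimately have "((\<lambda>t. m * X t) has_real_derivative V - d * X t + Y t) (at t within {0..})"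
      by simp
    from DERIV_cdivide[OF this, of m] show ?thesis using pos by simp
  qed
  have Y': "(Y has_real_derivative (- k * X t - Y t) / \<tau>) (at t within {0..})"
    if t: "t \<ge> 0" for t
  proof -
    have "((\<lambda>t. \<Sum>i\<in>UNIV. \<tau>i $ i * q t $ i) has_real_derivative
        (\<Sum>i\<in>UNIV. - inverse (ri $ i) * w t $ i - q t $ i)) (at t within {0..})"
      using traj t by (intro DERIV_sum) (auto simp: network_trajectory_def)
    moreover have "(\<Sum>i\<in>UNIV. - inverse (ri $ i) * w t $ i - q t $ i) = - k * X t - Y t"
      by (simp add: sum_subtractf par X_def Y_def sum_distrib_left sum_negf mult_ac)
    moreover have "(\<lambda>t. \<Sum>i\<in>UNIV. \<tau>i $ i * q t $ i) = (\<lambda>t. \<tau> * Y t)"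
      by (simp add: par Y_def sum_distrib_left)
    ultimately have "((\<lambda>t. \<tau> * Y t) has_real_derivative - k * X t - Y t) (at t within {0..})"
      by simp
    from DERIV_cdivide[OF this, of \<tau>] show ?thesis using pos by simp
  qed
  have sf: "system_frequency f w = (\<lambda>t. X t / F)"
    by (simp add: fun_eq_iff system_frequency_def X_def F_def)
  have "(V - d * X t + Y t) / m / F = (V / F - d * (X t / F) + Y t / F) / m"
    "(- k * X t - Y t) / \<tau> / F = (- k * (X t / F) - Y t / F) / \<tau>" for t
    using F pos by (auto simp: field_simps)
  then show ?thesis
    using DERIV_cdivide[OF X', of _ F] DERIV_cdivide[OF Y', of _ F] traj
    unfolding mean_machine_def sf F_def[symmetric] V_def[symmetric] Y_def[symmetric]
    by (auto simp: network_trajectory_def X_def Y_def)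
qed

section \<open>Uniqueness of the averaged trajectory\<close>

text \<open>An energy of the difference of two solutions starts at 0 and never grows. This
  identifies an arbitrary trajectory with the explicit response below.\<close>

lemma mean_machine_unique:
  assumes pos: "d > 0" "k > 0" "\<tau> > 0" "m > 0"
    and xy: "mean_machine d k \<tau> m U x y" and xy': "mean_machine d k \<tau> m U x' y'"
    and t: "t \<ge> 0"
  shows "x t = x' t"
proof -
  \<comment> \<open>The weights \<open>k * m\<close> and \<open>\<tau>\<close> make the mixed terms
    in \<open>x s - x' s\<close> and \<open>y s - y' s\<close> cancel in the derivative, leaving
    only dissipation.\<close>
  define V where "V s = k * m * (x s - x' s)\<^sup>2 + \<tau> * (y s - y' s)\<^sup>2" for s
  have V': "(V has_real_derivative - 2 * (k * d * (x s - x' s)\<^sup>2 + (y s - y' s)\<^sup>2)) (at s within {0..})"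
    if "s \<ge> 0" for s
  proof -
    have "(x has_real_derivative (U - d * x s + y s) / m) (at s within {0..})"
      "(y has_real_derivative (- k * x s - y s) / \<tau>) (at s within {0..})"
      "(x' has_real_derivative (U - d * x' s + y' s) / m) (at s within {0..})"
      "(y' has_real_derivative (- k * x' s - y' s) / \<tau>) (at s within {0..})"
      using xy xy' that by (auto simp: mean_machine_def)
    note der = this
    show ?thesis unfolding V_def
      by (rule derivative_eq_intros der refl)+
        (use pos in \<open>simp add: field_simps power2_eq_square\<close>)
  qed
  have "V t \<le> V 0"
  proof (rule DERIV_nonpos_imp_decreasing_open[OF t])
    fix s assume s: "0 < s" "s < t"
    \<comment> \<open>The one-sided derivative is two-sided away from 0; at the endpoint continuity
      suffices.\<close>
    then have "at s within {0..} = at s" by (intro at_within_interior) simp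
    with V'[of s] s have "(V has_real_derivative - 2 * (k * d * (x s - x' s)\<^sup>2 + (y s - y' s)\<^sup>2)) (at s)"
      by simp
    moreover have "- 2 * (k * d * (x s - x' s)\<^sup>2 + (y s - y' s)\<^sup>2) \<le> 0"
      using pos by (intro mult_nonpos_nonneg add_nonneg_nonneg) auto
    ultimately show "\<exists>D. (V has_real_derivative D) (at s) \<and> D \<le> 0" by blast
  next
    have "continuous_on {0..} V"
      using V' by (intro DERIV_continuous_on) auto
    then show "continuous_on {0..t} V" by (rule continuous_on_subset) auto
  qed
  also have "V 0 = 0" using xy xy' by (simp add: V_def mean_machine_def)
  finally have "k * m * (x t - x' t)\<^sup>2 \<le> 0"
    using mult_nonneg_nonneg[OF less_imp_le[OF pos(3)] zero_le_power2[of "y t - y' t"]]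
    unfolding V_def by linarith
  then show ?thesis using pos by (simp add: mult_le_0_iff)
qed

section \<open>Closed form of the unit step response\<close>

text \<open>Minus the discriminant of the characteristic polynomial
  \<open>m * \<tau> * s^2 + (m + d * \<tau>) * s + d + k\<close>, so positive exactly for complex
  roots when \<open>m\<close> and \<open>\<tau>\<close> are positive.\<close>

definition discrim :: "real \<Rightarrow> real \<Rightarrow> real \<Rightarrow> real \<Rightarrow> real" where
  "discrim d k \<tau> m = 4 * m * \<tau> * (d + k) - (m + d * \<tau>)\<^sup>2"

text \<open>With \<open>damped_freq\<close>, this gives the characteristic roots -\<eta> + i
  \<omega> and -\<eta> - i \<omega>.\<close>

definition decay_rate :: "real \<Rightarrow> real \<Rightarrow> real \<Rightarrow> real" where
  "decay_rate d \<tau> m = (m + d * \<tau>) / (2 * m * \<tau>)"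

definition damped_freq :: "real \<Rightarrow> real \<Rightarrow> real \<Rightarrow> real \<Rightarrow> real" where
  "damped_freq d k \<tau> m = sqrt (discrim d k \<tau> m) / (2 * m * \<tau>)"

text \<open>Using \<open>arccos\<close> puts the angle in (0, \<pi>) without a case split on the
  sign of \<open>d * \<tau> - m\<close>.\<close>

definition peak_phase :: "real \<Rightarrow> real \<Rightarrow> real \<Rightarrow> real \<Rightarrow> real" where
  "peak_phase d k \<tau> m = arccos ((d * \<tau> - m) / (2 * sqrt (k * m * \<tau>)))"

text \<open>The steady state is 1 / (d + k); the second summand is the overshoot at the first peak,
  with exponent -\<eta> \<phi> / \<omega>.\<close>

definition peak_gain :: "real \<Rightarrow> real \<Rightarrow> real \<Rightarrow> real \<Rightarrow> real" where
  "peak_gain d k \<tau> m =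
     (1 + sqrt (k * \<tau> / m) * exp (- ((m + d * \<tau>) / sqrt (discrim d k \<tau> m) * peak_phase d k \<tau> m))) / (d + k)"

text \<open>The phase is chosen so that the derivative is a multiple of
  \<open>- exp (- \<eta> t) * sin (\<omega> t - \<phi>)\<close>: the first peak sits at \<open>\<omega> t = \<phi>\<close>.\<close>

definition step_response :: "real \<Rightarrow> real \<Rightarrow> real \<Rightarrow> real \<Rightarrow> real \<Rightarrow> real" where
  "step_response d k \<tau> m t =
     (let \<eta> = decay_rate d \<tau> m; \<omega> = damped_freq d k \<tau> m; \<phi> = peak_phase d k \<tau> m in
      (1 + sqrt (k * \<tau> / m) * exp (- \<eta> * t) * (cos (\<omega> * t - \<phi>) + \<eta> / \<omega> * sin (\<omega> * t - \<phi>))) / (d + k))"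

lemma underdamped_iff_discrim:
  assumes "m > 0" "\<tau> > 0"
  shows "underdamped m d r \<tau> \<longleftrightarrow> discrim d (inverse r) \<tau> m > 0"
proof -
  have "(d + inverse r) / (m * \<tau>) - 1/4 * (1 / \<tau> + d / m)\<^sup>2
      = discrim d (inverse r) \<tau> m / (4 * m\<^sup>2 * \<tau>\<^sup>2)"
    using assms by (simp add: discrim_def field_simps power2_eq_square)
  moreover have "4 * m\<^sup>2 * \<tau>\<^sup>2 > 0" using assms by simp
  ultimately show ?thesis unfolding underdamped_def by (simp only: zero_less_divide_iff) auto
qed

text \<open>Both sides agree at 0, and \<open>x * cos x - sin x\<close> has derivative
  \<open>- (x * sin x)\<close>.\<close>

lemma sin_gt_mult_cos:
  fixes x :: real
  assumes "0 < x" "x < pi"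
  shows "x * cos x < sin x"
proof -
  have "\<exists>D. ((\<lambda>x. x * cos x - sin x) has_real_derivative D) (at s) \<and> D < 0"
    if "0 < s" "s < x" for s
  proof -
    have "((\<lambda>x. x * cos x - sin x) has_real_derivative - (s * sin s)) (at s)"
      by (auto intro!: derivative_eq_intros)
    moreover have "s * sin s > 0" using that assms by (simp add: sin_gt_zero)
    ultimately show ?thesis by (intro exI[of _ "- (s * sin s)"]) simp
  qed
  then have "(\<lambda>x. x * cos x - sin x) x < (\<lambda>x. x * cos x - sin x) 0"
    by (intro DERIV_neg_imp_decreasing_open[OF assms(1)] continuous_intros)
  then show ?thesis by simp
qed

context
  fixes d k \<tau> m :: real
  assumes pos: "d > 0" "k > 0" "\<tau> > 0" "m > 0"
    and discrim_pos: "discrim d k \<tau> m > 0"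
begin

private abbreviation "\<eta> \<equiv> decay_rate d \<tau> m"
private abbreviation "\<omega> \<equiv> damped_freq d k \<tau> m"
private abbreviation "\<phi> \<equiv> peak_phase d k \<tau> m"
private abbreviation "N \<equiv> discrim d k \<tau> m"

text \<open>This rests on \<open>(d * \<tau> - m)^2 + N = 4 * k * m * \<tau>\<close>. The strict
  bounds keep \<open>arccos\<close> where it is differentiable.\<close>

lemma cos_arg_bound:
  shows "((d * \<tau> - m) / (2 * sqrt (k * m * \<tau>)))\<^sup>2 = 1 - N / (4 * k * m * \<tau>)"
    and "-1 < (d * \<tau> - m) / (2 * sqrt (k * m * \<tau>))" "(d * \<tau> - m) / (2 * sqrt (k * m * \<tau>)) < 1"
proof -
  show *: "((d * \<tau> - m) / (2 * sqrt (k * m * \<tau>)))\<^sup>2 = 1 - N / (4 * k * m * \<tau>)"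
    using pos by (simp add: discrim_def power_divide power_mult_distrib)
      (simp add: field_simps power2_eq_square)
  have "N / (4 * k * m * \<tau>) > 0" using pos discrim_pos by simp
  with * have "((d * \<tau> - m) / (2 * sqrt (k * m * \<tau>)))\<^sup>2 < 1" by simp
  then have "\<bar>(d * \<tau> - m) / (2 * sqrt (k * m * \<tau>))\<bar> < 1"
    by (simp only: abs_square_less_1)
  then show "-1 < (d * \<tau> - m) / (2 * sqrt (k * m * \<tau>))" "(d * \<tau> - m) / (2 * sqrt (k * m * \<tau>)) < 1"
    by linarith+
qed

lemma
  shows cos_peak_phase: "cos \<phi> = (d * \<tau> - m) / (2 * sqrt (k * m * \<tau>))"
    and sin_peak_phase: "sin \<phi> = sqrt N / (2 * sqrt (k * m * \<tau>))"
    and peak_phase_bounds: "0 < \<phi>" "\<phi> < pi"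
proof -
  note b = cos_arg_bound
  show "cos \<phi> = (d * \<tau> - m) / (2 * sqrt (k * m * \<tau>))"
    unfolding peak_phase_def by (rule cos_arccos[OF less_imp_le[OF b(2)] less_imp_le[OF b(3)]])
  have "sin \<phi> = sqrt (1 - ((d * \<tau> - m) / (2 * sqrt (k * m * \<tau>)))\<^sup>2)"
    unfolding peak_phase_def by (rule sin_arccos[OF less_imp_le[OF b(2)] less_imp_le[OF b(3)]])
  also have "\<dots> = sqrt N / (2 * sqrt (k * m * \<tau>))"
    unfolding b(1) by (simp add: real_sqrt_divide real_sqrt_mult)
  finally show "sin \<phi> = sqrt N / (2 * sqrt (k * m * \<tau>))" .
  show "0 < \<phi>" "\<phi> < pi"
    unfolding peak_phase_def using arccos_lt_bounded[OF b(2,3)] by auto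
qed

lemma damped_freq_pos: "\<omega> > 0" and decay_rate_pos: "\<eta> > 0"
  using pos discrim_pos by (auto simp: damped_freq_def decay_rate_def add_pos_pos)

text \<open>The squared modulus of the complex roots is their product.\<close>

lemma decay_rate_damped_freq: "\<eta>\<^sup>2 + \<omega>\<^sup>2 = (d + k) / (m * \<tau>)"
  using pos discrim_pos
  by (simp add: decay_rate_def damped_freq_def power_divide)
    (simp add: discrim_def field_simps power2_eq_square)

lemma decay_rate_div_damped_freq: "\<eta> / \<omega> = (m + d * \<tau>) / sqrt N"
  using pos discrim_pos by (simp add: decay_rate_def damped_freq_def field_simps)

text \<open>The coefficient \<eta> / \<omega> of the sine is the one for which the cosine terms
  cancel on differentiation.\<close>

lemma step_response_deriv:
  "(step_response d k \<tau> m has_real_derivative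
     - (sqrt (k * \<tau> / m) / (m * \<tau> * \<omega>)) * (exp (- \<eta> * t) * sin (\<omega> * t - \<phi>))) (at t within S)"
proof (rule DERIV_cong)
  \<comment> \<open>Computed with free constants first, so that the algebra does not meet the
    radicals inside \<eta>, \<omega> and \<phi>.\<close>
  have "((\<lambda>t. (1 + \<rho> * exp (- a * t) * (cos (b * t - c) + a / b * sin (b * t - c))) / e) has_real_derivative
     - (\<rho> * ((a\<^sup>2 + b\<^sup>2) / b) / e) * (exp (- a * t) * sin (b * t - c))) (at t within S)"
    if "b > 0" "e > 0" for \<rho> a b c e :: real
  proof (rule DERIV_cong)
    show "((\<lambda>t. (1 + \<rho> * exp (- a * t) * (cos (b * t - c) + a / b * sin (b * t - c))) / e) has_real_derivative
      \<rho> * (exp (- a * t) * (- a) * (cos (b * t - c) + a / b * sin (b * t - c))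
        + exp (- a * t) * (- sin (b * t - c) * b + a / b * (cos (b * t - c) * b))) / e) (at t within S)"
      unfolding mult.assoc[of \<rho>]
    proof (intro DERIV_cdivide)
      have e: "((\<lambda>t. exp (- a * t)) has_real_derivative exp (- a * t) * (- a)) (at t within S)"
        by (auto intro!: derivative_eq_intros)
      have c: "((\<lambda>t. cos (b * t - c) + a / b * sin (b * t - c)) has_real_derivative
          - sin (b * t - c) * b + a / b * (cos (b * t - c) * b)) (at t within S)"
        using that by (auto intro!: derivative_eq_intros)
      show "((\<lambda>t. 1 + \<rho> * (exp (- a * t) * (cos (b * t - c) + a / b * sin (b * t - c)))) has_real_derivative
        \<rho> * (exp (- a * t) * (- a) * (cos (b * t - c) + a / b * sin (b * t - c))
        + exp (- a * t) * (- sin (b * t - c) * b + a / b * (cos (b * t - c) * b)))) (at t within S)"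
        using DERIV_add[OF DERIV_const[of 1] DERIV_cmult[OF DERIV_mult[OF e c], of \<rho>]]
        by (simp add: add.commute mult.commute)
    qed
    show "\<rho> * (exp (- a * t) * (- a) * (cos (b * t - c) + a / b * sin (b * t - c))
        + exp (- a * t) * (- sin (b * t - c) * b + a / b * (cos (b * t - c) * b))) / e
      = - (\<rho> * ((a\<^sup>2 + b\<^sup>2) / b) / e) * (exp (- a * t) * sin (b * t - c))"
      using that by (simp add: divide_simps) (simp add: algebra_simps power2_eq_square)
  qed
  then show "(step_response d k \<tau> m has_real_derivative
     - (sqrt (k * \<tau> / m) * ((\<eta>\<^sup>2 + \<omega>\<^sup>2) / \<omega>) / (d + k)) * (exp (- \<eta> * t) * sin (\<omega> * t - \<phi>))) (at t within S)"
    unfolding step_response_def Let_def using pos damped_freq_pos by simp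
  have "\<rho> * (e / (m * \<tau>) / \<omega>) / e = \<rho> / (m * \<tau> * \<omega>)" if "e > 0" for \<rho> e :: real
    using that by simp
  then show "- (sqrt (k * \<tau> / m) * ((\<eta>\<^sup>2 + \<omega>\<^sup>2) / \<omega>) / (d + k)) * (exp (- \<eta> * t) * sin (\<omega> * t - \<phi>))
     = - (sqrt (k * \<tau> / m) / (m * \<tau> * \<omega>)) * (exp (- \<eta> * t) * sin (\<omega> * t - \<phi>))"
    unfolding decay_rate_damped_freq using pos by simp
qed

lemma sqrt_ratio: "sqrt (k * \<tau> / m) / (2 * sqrt (k * m * \<tau>)) = 1 / (2 * m)"
proof -
  have "sqrt (k * \<tau> / m) * m = sqrt (k * m * \<tau>)"
    using pos by (intro real_sqrt_unique[symmetric])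
      (auto simp: power_mult_distrib, simp add: power2_eq_square)
  then show ?thesis using pos by (auto simp: field_simps)
qed

lemma step_response_0: "step_response d k \<tau> m 0 = 0"
proof -
  have "sqrt (k * \<tau> / m) * (cos \<phi> - \<eta> / \<omega> * sin \<phi>)
      = sqrt (k * \<tau> / m) / (2 * sqrt (k * m * \<tau>)) * (d * \<tau> - m - (m + d * \<tau>))"
    unfolding cos_peak_phase sin_peak_phase decay_rate_div_damped_freq
    using pos discrim_pos by (simp add: field_simps)
  also have "\<dots> = -1" unfolding sqrt_ratio using pos by (simp add: field_simps)
  finally show ?thesis by (simp add: step_response_def Let_def)
qed

text \<open>The left side is the slope of the response at time 0; the value 1 / m expresses zero
  initial turbine power.\<close>

lemma step_response_deriv_0: "sqrt (k * \<tau> / m) / (m * \<tau> * \<omega>) * sin \<phi> = 1 / m"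
proof -
  have "sqrt (k * \<tau> / m) / (m * \<tau> * \<omega>) * sin \<phi>
      = sqrt (k * \<tau> / m) / (2 * sqrt (k * m * \<tau>)) * (sqrt N / (m * \<tau> * \<omega>))"
    unfolding sin_peak_phase by simp
  also have "\<dots> = 1 / m"
    unfolding sqrt_ratio damped_freq_def using pos discrim_pos by (simp add: field_simps)
  finally show ?thesis .
qed

lemma step_response_mean_machine:
  "\<exists>y. mean_machine d k \<tau> m U (\<lambda>t. U * step_response d k \<tau> m t) y"
proof -
  define c where "c = sqrt (k * \<tau> / m) / (m * \<tau> * \<omega>)"
  define x where "x = step_response d k \<tau> m"
  define v where "v t = - c * (exp (- \<eta> * t) * sin (\<omega> * t - \<phi>))" for t
  \<comment> \<open>Obtained by solving the swing equation for the turbine power, so that only the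
    turbine equation carries content.\<close>
  define y where "y t = U * (m * v t + d * x t - 1)" for t
  have x': "(x has_real_derivative v t) (at t within S)" for t S
    unfolding x_def v_def c_def by (rule step_response_deriv)
  have v': "(v has_real_derivative
      c * exp (- \<eta> * t) * (\<eta> * sin (\<omega> * t - \<phi>) - \<omega> * cos (\<omega> * t - \<phi>))) (at t within S)" for t S
    unfolding v_def by (auto intro!: derivative_eq_intros simp: algebra_simps)
  have c: "sqrt (k * \<tau> / m) = c * m * \<tau> * \<omega>"
    using pos damped_freq_pos by (simp add: c_def)
  have x_eq: "(d + k) * x t = 1 + c * m * \<tau> * exp (- \<eta> * t) * (\<omega> * cos (\<omega> * t - \<phi>) + \<eta> * sin (\<omega> * t - \<phi>))" for t
  proof -
    have "A * \<omega> * e * (C + \<eta> / \<omega> * S) = A * e * (\<omega> * C + \<eta> * S)" for A e C S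
      using damped_freq_pos by (simp add: field_simps)
    note eq = this
    show ?thesis
      unfolding x_def step_response_def Let_def c eq using pos by simp
  qed
  have \<eta>: "2 * m * \<tau> * \<eta> = m + d * \<tau>" using pos by (simp add: decay_rate_def)
  \<comment> \<open>The second-order equation
    \<open>m * \<tau> * x'' + (m + d * \<tau>) * x' + (d + k) * x = 1\<close>, with
    \<open>x' = v\<close>.\<close>
  have osc: "m * \<tau> * (c * exp (- \<eta> * t) * (\<eta> * sin (\<omega> * t - \<phi>) - \<omega> * cos (\<omega> * t - \<phi>)))
      = 1 - (d + k) * x t - (m + d * \<tau>) * v t" for t
    unfolding x_eq \<eta>[symmetric] v_def by (simp add: algebra_simps)
  have "(y has_real_derivative (- k * (U * x t) - y t) / \<tau>) (at t within {0..})" for t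
  proof -
    define a where "a = c * exp (- \<eta> * t) * (\<eta> * sin (\<omega> * t - \<phi>) - \<omega> * cos (\<omega> * t - \<phi>))"
    have "m * \<tau> * a = 1 - (d + k) * x t - (m + d * \<tau>) * v t" using osc[of t] by (simp add: a_def)
    then have "U * (m * \<tau> * a) = U * (1 - (d + k) * x t - (m + d * \<tau>) * v t)" by simp
    then have "U * (m * a + d * v t) = (- k * (U * x t) - y t) / \<tau>"
      using pos by (simp add: y_def field_simps)
    moreover have "(y has_real_derivative U * (m * a + d * v t)) (at t within {0..})"
      unfolding y_def a_def by (rule derivative_eq_intros x' v' refl)+ simp
    ultimately show ?thesis by simp
  qed
  moreover have "((\<lambda>t. U * x t) has_real_derivative (U - d * (U * x t) + y t) / m) (at t within {0..})" for t
    by (rule derivative_eq_intros x' refl)+ (use pos in \<open>simp add: y_def algebra_simps\<close>)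
  moreover have "x 0 = 0" by (simp add: x_def step_response_0)
  moreover have "v 0 = 1 / m" using step_response_deriv_0 by (simp add: v_def c_def)
  ultimately have "mean_machine d k \<tau> m U (\<lambda>t. U * x t) y"
    using pos by (simp add: mean_machine_def y_def)
  then show ?thesis unfolding x_def by blast
qed

section \<open>First peak and sup norm\<close>

lemma step_response_peak: "step_response d k \<tau> m (\<phi> / \<omega>) = peak_gain d k \<tau> m"
proof -
  have "\<eta> * (\<phi> / \<omega>) = (m + d * \<tau>) / sqrt N * \<phi>"
    unfolding decay_rate_div_damped_freq[symmetric] by simp
  then have "exp (- \<eta> * (\<phi> / \<omega>)) = exp (- ((m + d * \<tau>) / sqrt N * \<phi>))" by simp
  moreover have "\<omega> * (\<phi> / \<omega>) - \<phi> = 0" using damped_freq_pos by simp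
  ultimately show ?thesis unfolding step_response_def Let_def peak_gain_def by simp
qed

lemma step_response_le_peak:
  assumes t: "t \<ge> 0"
  shows "\<bar>step_response d k \<tau> m t\<bar> \<le> peak_gain d k \<tau> m"
proof (cases "\<omega> * t \<le> \<phi>")
  case True
  have tle: "t \<le> \<phi> / \<omega>" using True damped_freq_pos by (simp add: field_simps)
  \<comment> \<open>Up to the first peak \<open>sin (\<omega> * t - \<phi>)\<close> is nonpositive,
    so the response rises from 0 to the peak value.\<close>
  have mono: "step_response d k \<tau> m a \<le> step_response d k \<tau> m b"
    if ab: "0 \<le> a" "a \<le> b" "b \<le> \<phi> / \<omega>" for a b
  proof (rule DERIV_nonneg_imp_nondecreasing[OF ab(2)])
    fix s assume s: "a \<le> s" "s \<le> b"
    have "\<omega> * s \<le> \<omega> * (\<phi> / \<omega>)" "0 \<le> \<omega> * s"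
      using s ab damped_freq_pos by (intro mult_left_mono mult_nonneg_nonneg; linarith)+
    then have "\<omega> * s \<le> \<phi>" "0 \<le> \<omega> * s" using damped_freq_pos by auto
    then have "sin (\<phi> - \<omega> * s) \<ge> 0" using peak_phase_bounds by (intro sin_ge_zero) auto
    moreover have "sin (\<omega> * s - \<phi>) = - sin (\<phi> - \<omega> * s)"
      by (metis minus_diff_eq sin_minus)
    ultimately have "0 \<le> - (sqrt (k * \<tau> / m) / (m * \<tau> * \<omega>)) * (exp (- \<eta> * s) * sin (\<omega> * s - \<phi>))"
      using pos damped_freq_pos by simp
    with step_response_deriv[of s UNIV]
    show "\<exists>y. (step_response d k \<tau> m has_real_derivative y) (at s) \<and> 0 \<le> y"
      by blast
  qed
  from mono[of 0 t] mono[of t "\<phi> / \<omega>"] t tle show ?thesis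
    by (simp add: step_response_0 step_response_peak)
next
  case False
  \<comment> \<open>Past the peak, \<open>s\<close> is the phase elapsed since it; the bound on the
    oscillation is an equality at \<open>s = 0\<close>.\<close>
  define s where "s = \<omega> * t - \<phi>"
  define \<delta> where "\<delta> = \<eta> / \<omega>"
  have s: "s > 0" and \<delta>: "\<delta> > 0"
    using False damped_freq_pos decay_rate_pos by (auto simp: s_def \<delta>_def)
  have "\<bar>cos s + \<delta> * sin s\<bar> \<le> \<bar>cos s\<bar> + \<delta> * \<bar>sin s\<bar>"
    using \<delta> by (metis abs_mult abs_of_pos abs_triangle_ineq)
  also have "\<dots> \<le> 1 + \<delta> * s"
    using \<delta> s abs_sin_x_le_abs_x[of s] by (intro add_mono mult_left_mono) auto
  also have "\<dots> \<le> exp (\<delta> * s)" by (rule exp_ge_add_one_self)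
  finally have "exp (- \<eta> * t) * \<bar>cos s + \<delta> * sin s\<bar> \<le> exp (- \<eta> * t) * exp (\<delta> * s)"
    by (intro mult_left_mono) auto
  \<comment> \<open>Since \<eta> t = \<delta> (s + \<phi>), the growth
    \<open>exp (\<delta> * s)\<close> of the bound is absorbed by the decay.\<close>
  also have "\<dots> = exp (- \<delta> * \<phi>)"
    using damped_freq_pos by (simp add: exp_add[symmetric] s_def \<delta>_def field_simps)
  finally have "\<bar>exp (- \<eta> * t) * (cos s + \<delta> * sin s)\<bar> \<le> exp (- \<delta> * \<phi>)"
    by (simp add: abs_mult)
  then have "\<bar>sqrt (k * \<tau> / m) * (exp (- \<eta> * t) * (cos s + \<delta> * sin s))\<bar> \<le> sqrt (k * \<tau> / m) * exp (- \<delta> * \<phi>)"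
    using pos by (simp add: abs_mult mult_left_mono)
  then have "\<bar>1 + sqrt (k * \<tau> / m) * (exp (- \<eta> * t) * (cos s + \<delta> * sin s))\<bar>
      \<le> 1 + sqrt (k * \<tau> / m) * exp (- \<delta> * \<phi>)" by linarith
  then have "\<bar>1 + sqrt (k * \<tau> / m) * (exp (- \<eta> * t) * (cos s + \<delta> * sin s))\<bar> / (d + k)
      \<le> (1 + sqrt (k * \<tau> / m) * exp (- \<delta> * \<phi>)) / (d + k)"
    using pos by (intro divide_right_mono) auto
  then show ?thesis
    using pos unfolding step_response_def peak_gain_def Let_def s_def \<delta>_def decay_rate_div_damped_freq
    by (simp add: mult.assoc)
qed

lemma sup_norm_mean_machine:
  assumes "mean_machine d k \<tau> m U x y"
  shows "sup_norm x = \<bar>U\<bar> * peak_gain d k \<tau> m"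
proof -
  obtain y' where "mean_machine d k \<tau> m U (\<lambda>t. U * step_response d k \<tau> m t) y'"
    using step_response_mean_machine by blast
  then have x: "x t = U * step_response d k \<tau> m t" if "t \<ge> 0" for t
    using mean_machine_unique[OF pos assms _ that] by blast
  have gain: "peak_gain d k \<tau> m \<ge> 0"
    using step_response_le_peak[of 0] by simp
  have peak: "\<phi> / \<omega> \<ge> 0" using peak_phase_bounds damped_freq_pos by simp
  have "\<bar>x (\<phi> / \<omega>)\<bar> = \<bar>U\<bar> * peak_gain d k \<tau> m"
    using gain by (simp add: x[OF peak] step_response_peak abs_mult)
  \<comment> \<open>The supremum is an attained maximum, so it does not fall under the unspecified
    unbounded case.\<close>
  then show ?thesis unfolding sup_norm_def using peak
    by (intro cSup_eq_maximum)
      (auto simp: x abs_mult step_response_le_peak mult_left_mono intro!: image_eqI[of _ _ "\<phi> / \<omega>"])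
qed

section \<open>Derivative of the peak value in the mass\<close>

text \<open>With \<open>\<rho>\<close> the gain in front of the exponential, the logarithmic derivative of
  \<open>\<rho> exp (- \<eta> \<phi> / \<omega>)\<close> collapses to \<open>- 2 \<tau> (d + k) / N * (1 - \<phi> cot \<phi>)\<close>.\<close>

lemma peak_gain_deriv:
  "\<exists>D<0. (peak_gain d k \<tau> has_real_derivative D) (at m)"
proof -
  \<comment> \<open>Naming the radicals lets quotients be brought to a form where
    \<open>R * R\<close> and \<open>K * K\<close> are replaced by polynomials.\<close>
  define R where "R = sqrt N"
  define K where "K = sqrt (k * m * \<tau>)"
  have R: "R > 0" "R * R = N" and K: "K > 0" "K * K = k * m * \<tau>"
    using pos discrim_pos by (auto simp: R_def K_def)
  have N_eq: "N = 4 * m * \<tau> * (d + k) - (m + d * \<tau>)\<^sup>2" by (rule discrim_def)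
  have N': "(discrim d k \<tau> has_real_derivative 4 * \<tau> * (d + k) - 2 * (m + d * \<tau>)) (at m)"
    unfolding discrim_def by (auto intro!: derivative_eq_intros simp: algebra_simps)
  have sqrtN': "((\<lambda>m. sqrt (discrim d k \<tau> m)) has_real_derivative
      (2 * \<tau> * (d + k) - (m + d * \<tau>)) / R) (at m)"
    by (rule DERIV_cong[OF DERIV_chain2[OF DERIV_real_sqrt[OF discrim_pos] N']])
      (use R(1) in \<open>simp add: R_def[symmetric] field_simps\<close>)
  have K': "((\<lambda>m. sqrt (k * m * \<tau>)) has_real_derivative k * \<tau> / (2 * K)) (at m)"
  proof (rule DERIV_cong)
    have "((\<lambda>m. k * m * \<tau>) has_real_derivative k * \<tau>) (at m)"
      by (auto intro!: derivative_eq_intros)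
    then show "((\<lambda>m. sqrt (k * m * \<tau>)) has_real_derivative inverse K / 2 * (k * \<tau>)) (at m)"
      unfolding K_def using pos by (intro DERIV_chain2[OF DERIV_real_sqrt]) auto
    show "inverse K / 2 * (k * \<tau>) = k * \<tau> / (2 * K)" by (simp add: field_simps)
  qed
  have c': "((\<lambda>m. (d * \<tau> - m) / (2 * sqrt (k * m * \<tau>))) has_real_derivative
      - (m + d * \<tau>) / (4 * m * K)) (at m)"
  proof (rule DERIV_cong)
    show "((\<lambda>m. (d * \<tau> - m) / (2 * sqrt (k * m * \<tau>))) has_real_derivative
       ((- 1) * (2 * K) - (d * \<tau> - m) * (k * \<tau> / K)) / (2 * K * (2 * K))) (at m)"
    proof -
      have "((\<lambda>m. d * \<tau> - m) has_real_derivative - 1) (at m)"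
        by (auto intro!: derivative_eq_intros)
      moreover have "((\<lambda>m. 2 * sqrt (k * m * \<tau>)) has_real_derivative k * \<tau> / K) (at m)"
        using DERIV_cmult[OF K', of 2] by simp
      moreover have "2 * sqrt (k * m * \<tau>) \<noteq> 0" using K(1) unfolding K_def by linarith
      ultimately show ?thesis unfolding K_def by (rule DERIV_divide)
    qed
    have "((- 1) * (2 * K) - (d * \<tau> - m) * (k * \<tau> / K)) / (2 * K * (2 * K))
       = - (2 * (K * K) + (d * \<tau> - m) * (k * \<tau>)) / (4 * (K * K) * K)"
      using K(1) by (simp add: divide_simps)
    also have "\<dots> = - (m + d * \<tau>) / (4 * m * K)"
      unfolding K(2) using pos K(1) by (simp add: divide_simps) (simp add: algebra_simps)
    finally show "((- 1) * (2 * K) - (d * \<tau> - m) * (k * \<tau> / K)) / (2 * K * (2 * K))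
       = - (m + d * \<tau>) / (4 * m * K)" .
  qed
  have phi': "(peak_phase d k \<tau> has_real_derivative (m + d * \<tau>) / (2 * m * R)) (at m)"
  proof (rule DERIV_cong)
    \<comment> \<open>This is sin \<phi>, the denominator in the derivative of
      \<open>arccos\<close>.\<close>
    have "sqrt (1 - ((d * \<tau> - m) / (2 * sqrt (k * m * \<tau>)))\<^sup>2) = R / (2 * K)"
      unfolding cos_arg_bound(1) R_def K_def by (simp add: real_sqrt_divide real_sqrt_mult)
    note s = this
    show "(peak_phase d k \<tau> has_real_derivative
       inverse (- (R / (2 * K))) * (- (m + d * \<tau>) / (4 * m * K))) (at m)"
      unfolding peak_phase_def s[symmetric]
      by (rule DERIV_chain2[OF DERIV_arccos[OF cos_arg_bound(2,3)] c'])
    show "inverse (- (R / (2 * K))) * (- (m + d * \<tau>) / (4 * m * K)) = (m + d * \<tau>) / (2 * m * R)"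
      using pos R(1) K(1) by (simp add: field_simps)
  qed
  define E where "E m = - ((m + d * \<tau>) / sqrt (discrim d k \<tau> m) * peak_phase d k \<tau> m)" for m
  define E' where "E' = - (2 * \<tau> * (d + k) * (m - d * \<tau>) / (N * R) * \<phi> + (m + d * \<tau>)\<^sup>2 / (2 * m * N))"
  have E': "(E has_real_derivative E') (at m)"
  proof (rule DERIV_cong)
    have "((\<lambda>m. m + d * \<tau>) has_real_derivative 1) (at m)"
      by (auto intro!: derivative_eq_intros)
    then have "((\<lambda>m. (m + d * \<tau>) / sqrt (discrim d k \<tau> m)) has_real_derivative
       (1 * R - (m + d * \<tau>) * ((2 * \<tau> * (d + k) - (m + d * \<tau>)) / R)) / (R * R)) (at m)"
      unfolding R_def by (rule DERIV_divide) (use sqrtN' discrim_pos in \<open>auto simp: R_def\<close>)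
    from DERIV_minus[OF DERIV_mult[OF this phi']]
    show "(E has_real_derivative
       - ((1 * R - (m + d * \<tau>) * ((2 * \<tau> * (d + k) - (m + d * \<tau>)) / R)) / (R * R) * \<phi>
        + (m + d * \<tau>) / (2 * m * R) * ((m + d * \<tau>) / R))) (at m)"
      unfolding E_def R_def .
    have "(1 * R - (m + d * \<tau>) * ((2 * \<tau> * (d + k) - (m + d * \<tau>)) / R)) / (R * R)
       = (R * R - (m + d * \<tau>) * (2 * \<tau> * (d + k) - (m + d * \<tau>))) / (R * R * R)"
      using R(1) by (simp add: divide_simps)
    \<comment> \<open>Inserting \<open>N\<close>, the squares of \<open>m + d * \<tau>\<close>
      cancel and the common factor \<open>2 * \<tau> * (d + k)\<close> comes out.\<close>
    also have "R * R - (m + d * \<tau>) * (2 * \<tau> * (d + k) - (m + d * \<tau>)) = 2 * \<tau> * (d + k) * (m - d * \<tau>)"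
      unfolding R(2) N_eq by (simp add: algebra_simps power2_eq_square)
    finally have 1: "(1 * R - (m + d * \<tau>) * ((2 * \<tau> * (d + k) - (m + d * \<tau>)) / R)) / (R * R)
       = 2 * \<tau> * (d + k) * (m - d * \<tau>) / (N * R)" unfolding R(2) .
    have 2: "(m + d * \<tau>) / (2 * m * R) * ((m + d * \<tau>) / R) = (m + d * \<tau>)\<^sup>2 / (2 * m * N)"
      by (simp add: R(2)[symmetric] power2_eq_square mult_ac)
    show "- ((1 * R - (m + d * \<tau>) * ((2 * \<tau> * (d + k) - (m + d * \<tau>)) / R)) / (R * R) * \<phi>
        + (m + d * \<tau>) / (2 * m * R) * ((m + d * \<tau>) / R)) = E'"
      unfolding 1 2 E'_def by simp
  qed
  define \<rho> where "\<rho> m = sqrt (k * \<tau> / m)" for m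
  have rho: "\<rho> m > 0" "(\<rho> m)\<^sup>2 = k * \<tau> / m" using pos by (auto simp: \<rho>_def)
  have rho': "(\<rho> has_real_derivative - \<rho> m / (2 * m)) (at m)"
  proof (rule DERIV_cong)
    have "((\<lambda>m. k * \<tau> / m) has_real_derivative - (k * \<tau> / m / m)) (at m)"
      using pos by (auto intro!: derivative_eq_intros)
    then show "(\<rho> has_real_derivative inverse (\<rho> m) / 2 * - (k * \<tau> / m / m)) (at m)"
      unfolding \<rho>_def using pos by (intro DERIV_chain2[OF DERIV_real_sqrt]) auto
    show "inverse (\<rho> m) / 2 * - (k * \<tau> / m / m) = - \<rho> m / (2 * m)"
      unfolding rho(2)[symmetric] using rho(1) pos by (simp add: field_simps power2_eq_square)
  qed
  define D where "D = (- \<rho> m / (2 * m) * exp (E m) + exp (E m) * E' * \<rho> m) / (d + k)"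
  have gain: "peak_gain d k \<tau> = (\<lambda>m. (1 + \<rho> m * exp (E m)) / (d + k))"
    by (simp add: fun_eq_iff peak_gain_def \<rho>_def E_def)
  have "(peak_gain d k \<tau> has_real_derivative D) (at m)"
    unfolding gain D_def
    by (intro DERIV_cdivide) (rule derivative_eq_intros rho' E' refl | simp)+
  moreover have "D < 0"
  proof -
    \<comment> \<open>That is, cot \<phi> = (d \<tau> - m) / R, stated without division.\<close>
    have cot: "cos \<phi> * R = sin \<phi> * (d * \<tau> - m)"
      unfolding cos_peak_phase sin_peak_phase R_def by simp
    have sin: "sin \<phi> > 0" using peak_phase_bounds by (simp add: sin_gt_zero)
    have "\<phi> * (d * \<tau> - m) * sin \<phi> = \<phi> * cos \<phi> * R" using cot by (simp add: mult_ac)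
    also have "\<dots> < sin \<phi> * R" using sin_gt_mult_cos[OF peak_phase_bounds] R(1) by simp
    finally have "\<phi> * (d * \<tau> - m) < R" using sin by (simp add: mult.commute)
    then have *: "2 * \<tau> * (d + k) / (N * R) * (R - \<phi> * (d * \<tau> - m)) > 0"
      using pos R(1) discrim_pos by simp
    \<comment> \<open>Minus the logarithmic derivative of \<open>\<rho> m * exp (E m)\<close>; its
      positivity is the required sign.\<close>
    have "1 / (2 * m) - E' = (N + (m + d * \<tau>)\<^sup>2) / (2 * m * N)
        + 2 * \<tau> * (d + k) * (m - d * \<tau>) / (N * R) * \<phi>"
      unfolding E'_def using pos discrim_pos by (simp add: add_divide_distrib)
    also have "N + (m + d * \<tau>)\<^sup>2 = 4 * m * \<tau> * (d + k)" unfolding N_eq by simp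
    also have "4 * m * \<tau> * (d + k) / (2 * m * N) + 2 * \<tau> * (d + k) * (m - d * \<tau>) / (N * R) * \<phi>
        = 2 * \<tau> * (d + k) / (N * R) * (R - \<phi> * (d * \<tau> - m))"
      using pos discrim_pos R(1) by (simp add: divide_simps) (simp add: algebra_simps)
    finally have "1 / (2 * m) - E' > 0" using * by simp
    moreover have "D = - (\<rho> m * exp (E m) * (1 / (2 * m) - E')) / (d + k)"
      unfolding D_def by (simp add: algebra_simps)
    ultimately show ?thesis using rho(1) pos by simp
  qed
  ultimately show ?thesis by blast
qed

end

section \<open>Monotonicity over the under-damped masses\<close>

lemma discrim_pos_interval:
  assumes "discrim d k \<tau> a > 0" "discrim d k \<tau> b > 0" "a \<le> x" "x \<le> b"
  shows "discrim d k \<tau> x > 0"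
proof (cases "a = x \<or> x = b")
  case False
  then have lt: "a < x" "x < b" using assms by auto
  \<comment> \<open>Linear interpolation of a quadratic with leading coefficient -1; the last term
    is the positive gap above the chord.\<close>
  have "(b - a) * discrim d k \<tau> x
      = (b - x) * discrim d k \<tau> a + (x - a) * discrim d k \<tau> b + (x - a) * (b - x) * (b - a)"
    unfolding discrim_def by algebra
  also have "\<dots> > 0" using lt assms by (intro add_pos_pos mult_pos_pos) auto
  finally show ?thesis using lt by (simp add: zero_less_mult_iff)
qed (use assms in auto)

theorem proposition4:
  fixes L :: "real^'n::finite^'n"
    and f di ri \<tau>i u0 :: "real^'n"
    and mi :: "real \<Rightarrow> real^'n"
    and d r \<tau> :: real
    and \<theta> w q :: "real \<Rightarrow> real \<Rightarrow> real^'n"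
  assumes "network_laplacian L"
    and "\<And>i. f $ i > 0" and "d > 0" and "r > 0" and "\<tau> > 0"
    and "\<And>m i. mi m $ i = f $ i * m"
    and "\<And>i. di $ i = f $ i * d"
    and "\<And>i. inverse (ri $ i) = f $ i * inverse r"
    and "\<And>i. \<tau>i $ i = \<tau>"
    and "(\<Sum>i\<in>UNIV. u0 $ i) \<noteq> 0"
    and "\<And>m. m > 0 \<Longrightarrow>
           network_trajectory L (mi m) di ri \<tau>i (step_input u0) (\<theta> m) (w m) (q m)"
  shows "(\<forall>m>0. underdamped m d r \<tau> \<longrightarrow>
            (\<exists>D<0. ((\<lambda>m. sup_norm (system_frequency f (w m))) has_real_derivative D) (at m))) \<and>
         strict_antimono_on {m. m > 0 \<and> underdamped m d r \<tau>}
            (\<lambda>m. sup_norm (system_frequency f (w m)))"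
proof -
  define k where "k = inverse r"
  define U where "U = (\<Sum>i\<in>UNIV. u0 $ i) / (\<Sum>i\<in>UNIV. f $ i)"
  define S where "S = {m. 0 < m \<and> 0 < discrim d k \<tau> m}"
  let ?g = "\<lambda>m. sup_norm (system_frequency f (w m))"
  have k: "k > 0" using assms(4) by (simp add: k_def)
  have "(\<Sum>i\<in>UNIV. f $ i) > 0" by (rule sum_pos) (auto simp: assms(2))
  \<comment> \<open>A nonzero total disturbance keeps the norm from being constantly 0.\<close>
  then have U: "\<bar>U\<bar> > 0" using assms(10) by (simp add: U_def)
  have S: "{m. m > 0 \<and> underdamped m d r \<tau>} = S"
    using underdamped_iff_discrim[OF _ assms(5)] by (auto simp: S_def k_def)
  \<comment> \<open>The closed form of the norm is available only on \<open>S\<close>; openness lets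
    its derivative pass to the norm itself.\<close>
  have "open S" unfolding S_def discrim_def
    by (intro open_Collect_conj open_Collect_less continuous_intros)
  have g: "?g m = \<bar>U\<bar> * peak_gain d k \<tau> m" if "m \<in> S" for m
  proof -
    have m: "m > 0" "discrim d k \<tau> m > 0" using that by (auto simp: S_def)
    have "mean_machine d k \<tau> m U (system_frequency f (w m))
        (\<lambda>t. (\<Sum>i\<in>UNIV. q m t $ i) / (\<Sum>i\<in>UNIV. f $ i))"
      unfolding U_def
      by (rule network_trajectory_mean_machine[OF assms(1) assms(11)[OF m(1)] assms(2) m(1) assms(5)])
        (simp_all add: assms k_def)
    then show ?thesis
      by (rule sup_norm_mean_machine[OF assms(3) k assms(5) m])
  qed
  have der: "\<exists>D<0. (?g has_real_derivative D) (at m)" if "m \<in> S" for m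
  proof -
    obtain D where D: "D < 0" "(peak_gain d k \<tau> has_real_derivative D) (at m)"
      using peak_gain_deriv[OF assms(3) k assms(5)] \<open>m \<in> S\<close> unfolding S_def by blast
    have "(?g has_real_derivative \<bar>U\<bar> * D) (at m)"
      using DERIV_cmult[OF D(2)] \<open>open S\<close> \<open>m \<in> S\<close>
      by (rule has_field_derivative_transform_within_open) (simp add: g)
    moreover have "\<bar>U\<bar> * D < 0" using U D(1) by (rule mult_pos_neg)
    ultimately show ?thesis by blast
  qed
  have "?g b < ?g a" if "a \<in> S" "b \<in> S" "a < b" for a b
  proof (rule DERIV_neg_imp_decreasing[OF \<open>a < b\<close>])
    fix x assume "a \<le> x" "x \<le> b"
    \<comment> \<open>The sign of the derivative is needed on all of [a, b], hence the interval
      property of \<open>S\<close>.\<close>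
    then have "x \<in> S" using that discrim_pos_interval[of d k \<tau> a b x] by (auto simp: S_def)
    then show "\<exists>y. (?g has_real_derivative y) (at x) \<and> y < 0" using der by blast
  qed
  then have "strict_antimono_on S ?g" by (auto simp: monotone_on_def)
  moreover have "\<forall>m>0. underdamped m d r \<tau> \<longrightarrow> (\<exists>D<0. (?g has_real_derivative D) (at m))"
    using der S by blast
  ultimately show ?thesis unfolding S by blast
qed

end
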